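(* Let $x$ be either the smallest or the greatest fixed point of the Minkowski question mark function $?$ in the open interval $(0,\frac12)$, and let $x=[a_1,a_2,\ldots,a_n,\ldots]$ be its continued fraction expansion. Then $a_1=2$ and $$a_{n+1}\le \sum_{i=1}^{n} a_i\qquad\text{for all } n\in\mathbb{N}.$$
   Context: For positive integers $a_j$, $[a_1,a_2,\ldots]=\cfrac{1}{a_1+\cfrac{1}{a_2+\cdots}}$ denotes the (finite or infinite) continued fraction with zero integer part. The Minkowski question mark function $?:[0,1]\to[0,1]$ is defined by $?(0)=0$ and, for $x=[a_1,a_2,\ldots]\in(0,1]$, by $$?(x)=\sum_{k\ge 1}\frac{(-1)^{k+1}}{2^{a_1+\cdots+a_k-1}},$$ the sum being infinite if $x$ is irrational and finite (over all partial quotients) if $x$ is rational; the value does not depend on which of the two finite expansions of a rational number is used. The function $?$ is continuous and strictly increasing, with $?(0)=0$, $?(\frac12)=\frac12$, $?(1)=1$. A fixed point is a solution of $?(x)=x$. All fixed points in $(0,\frac12)$ are irrational, and the smallest and the greatest fixed points in $(0,\frac12)$ exist (they might coincide). $\mathbb{N}=\{1,2,3,\ldots\}$. *)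

theory Defs
  imports "HOL-Analysis.Analysis"
begin

primrec cf_value :: "nat list \<Rightarrow> real" where
  "cf_value [] = 0"
| "cf_value (b # bs) = 1 / (real b + cf_value bs)"

definition is_finite_cf :: "nat list \<Rightarrow> real \<Rightarrow> bool" where
  "is_finite_cf as x \<longleftrightarrow> as \<noteq> [] \<and> (\<forall>b\<in>set as. b > 0) \<and> cf_value as = x"

(* Partial quotients of infinite expansions are indexed from 1: the sequence is
   a 1, a 2, ..., and the value a 0 plays no role. *)

definition is_infinite_cf :: "(nat \<Rightarrow> nat) \<Rightarrow> real \<Rightarrow> bool" where
  "is_infinite_cf a x \<longleftrightarrow>
     (\<forall>n\<ge>1. a n > 0) \<and> (\<lambda>n. cf_value (map a [1..<Suc n])) \<longlonglongrightarrow> x"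

definition question_mark_finite :: "nat list \<Rightarrow> real" where
  "question_mark_finite as =
     (\<Sum>k=1..length as. (-1) ^ (k + 1) / 2 ^ (sum_list (take k as) - 1))"

(* The series over k >= 1 is shifted to start at 0, which turns k into Suc k. *)
definition question_mark_infinite :: "(nat \<Rightarrow> nat) \<Rightarrow> real" where
  "question_mark_infinite a =
     (\<Sum>k. (-1) ^ (Suc k + 1) / 2 ^ ((\<Sum>i=1..Suc k. a i) - 1))"

(* The choice operators are harmless on (0,1]: an irrational number has only one infinite
   expansion (up to the irrelevant a 0), and the two finite expansions of a rational
   number yield the same sum. Values outside [0,1] are unspecified. *)
definition question_mark :: "real \<Rightarrow> real" where
  "question_mark x =
     (if x = 0 then 0
      else if x \<in> \<rat> then question_mark_finite (SOME as. is_finite_cf as x)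
      else question_mark_infinite (SOME a. is_infinite_cf a x))"

definition fixed_points :: "real set" where
  "fixed_points = {x. 0 < x \<and> x < 1/2 \<and> question_mark x = x}"

end

theory Submission
  imports Defs
begin

text \<open>
  Write \<open>Q\<close> for the question mark function, \<open>r n\<close> for the \<open>n\<close>-th convergent of the fixed point
  \<open>x\<close>, \<open>q n\<close> for its denominator and \<open>S n = a 1 + \<dots> + a n\<close>. If \<open>x\<close> has tail \<open>t\<close> after \<open>n\<close> partial
  quotients, then \<open>x - r n = (-1)^n * t / (q n * (q n + q (n - 1) * t))\<close> and
  \<open>Q x - Q (r n) = (-1)^n * Q t / 2 ^ S n\<close>, where \<open>Q t\<close> is at most \<open>2 / 2 ^ a (n + 1)\<close>.

  Extremality of \<open>x\<close> and continuity of \<open>Q\<close> give \<open>Q y < y\<close> on \<open>(0, x)\<close> for the smallest fixed point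
  and \<open>Q y > y\<close> on \<open>(x, 1/2)\<close> for the greatest one. The convergents lie alternately on the two sides
  of \<open>x\<close>, so of any two consecutive ones with index at least \<open>2\<close>, one is \<^emph>\<open>outer\<close>: it lies on the
  side where the sign of \<open>Q - id\<close> is known. For an outer \<open>r n\<close> the difference \<open>Q x - Q (r n)\<close> exceeds \<open>x - r n\<close> in absolute
  value by \<open>\<bar>r n - Q (r n)\<bar>\<close>, a positive rational number with denominator \<open>q n * 2 ^ S n\<close>
  (lemma \<open>fixed_point_outer_convergent\<close>).

  \<^item> If \<open>r n\<close> is outer, the size of this excess forces \<open>2 ^ a (n + 1) \<le> 2 * q n\<close>, and
    \<open>q n < 2 ^ S n\<close> yields \<open>a (n + 1) \<le> S n\<close>.

  \<^item> If \<open>r (n + 1)\<close> is outer and \<open>a (n + 1) > S n\<close>, then already \<open>\<bar>Q x - Q (r (n + 1))\<bar> > \<bar>x - r (n + 1)\<bar>\<close>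
    is impossible: the left side is at most \<open>2 / 2 ^ (S n + a (n + 1) + a (n + 2))\<close>, whereas the right
    side is at least of the order of \<open>1 / (a (n + 2) * (a (n + 1) * q n)^2)\<close>, and \<open>(q n)^2\<close> grows
    more slowly than \<open>4 ^ S n\<close>. The constants are good enough from \<open>n = 6\<close> on, where \<open>S n \<ge> 10\<close>.

  The remaining small \<open>n\<close> are settled by locating the fixed points: all those in \<open>(0, 1/2)\<close> lie in
  \<open>(29/69, 37/88)\<close>, hence their expansions begin with \<open>2, 2, 1, 1, 1, 3\<close>
  (lemma \<open>fixed_point_first_digits\<close>).

  The analytic properties of \<open>Q\<close> come from a second construction, as the continuous monotone function
  on \<open>[0, 1]\<close> with \<open>Q (z / (1 + z)) = Q z / 2\<close> and \<open>Q (1 / (1 + z)) = 1 - Q z / 2\<close>; evaluating it along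
  continued fractions reproduces the defining series (lemma \<open>question_mark_eq_minkowski\<close>).
\<close>

section \<open>The question mark function as a continuous solution of functional equations\<close>

text \<open>
  The \<open>k\<close>-th iterate, started at the identity, of the operator on functions on \<open>[0, 1]\<close> whose fixed
  points are the solutions of the two functional equations. The operator contracts the supremum
  distance by the factor \<open>1/2\<close>. At \<open>y = 1/2\<close> both branches agree because the value at \<open>1\<close> is \<open>1\<close>.
\<close>

primrec minkowski_approx :: "nat \<Rightarrow> real \<Rightarrow> real" where
  "minkowski_approx 0 y = y"
| "minkowski_approx (Suc k) y =
     (if y \<le> 1/2 then minkowski_approx k (y / (1 - y)) / 2
      else 1 - minkowski_approx k ((1 - y) / y) / 2)"

lemma left_branch_in_unit: "y \<in> {0..1/2} \<Longrightarrow> y / (1 - y) \<in> {0..1::real}"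
  by (auto simp: field_simps)

lemma right_branch_in_unit: "y \<in> {1/2..1} \<Longrightarrow> (1 - y) / y \<in> {0..1::real}"
  by (auto simp: field_simps)

lemma minkowski_approx_0: "minkowski_approx k 0 = 0"
  by (induction k) auto

lemma minkowski_approx_1: "minkowski_approx k 1 = 1"
  by (cases k) (auto simp: minkowski_approx_0)

lemma minkowski_approx_mono:
  "0 \<le> y \<Longrightarrow> y \<le> z \<Longrightarrow> z \<le> 1 \<Longrightarrow> minkowski_approx k y \<le> minkowski_approx k z"
proof (induction k arbitrary: y z)
  case (Suc k)
  have upper: "minkowski_approx k u \<le> 1" if "0 \<le> u" "u \<le> 1" for u
    using Suc.IH[of u 1] that by (simp add: minkowski_approx_1)
  consider "z \<le> 1/2" | "y \<le> 1/2" "1/2 < z" | "1/2 < y"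
    by linarith
  then show ?case
  proof cases
    case 1
    have "minkowski_approx k (y / (1 - y)) \<le> minkowski_approx k (z / (1 - z))"
      using 1 Suc.prems by (intro Suc.IH) (auto simp: field_simps)
    with 1 Suc.prems show ?thesis by simp
  next
    case 2
    have "minkowski_approx k (y / (1 - y)) \<le> 1" "minkowski_approx k ((1 - z) / z) \<le> 1"
      using 2 Suc.prems left_branch_in_unit[of y] right_branch_in_unit[of z]
      by (auto intro!: upper)
    with 2 show ?thesis by simp
  next
    case 3
    have "minkowski_approx k ((1 - z) / z) \<le> minkowski_approx k ((1 - y) / y)"
      using 3 Suc.prems by (intro Suc.IH) (auto simp: field_simps)
    with 3 Suc.prems show ?thesis by simp
  qed
qed simp

lemma continuous_on_minkowski_approx: "continuous_on {0..1} (minkowski_approx k)"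
proof (induction k)
  case 0
  then show ?case by simp
next
  case (Suc k)
  have left: "continuous_on {0..1/2} (\<lambda>y. minkowski_approx k (y / (1 - y)) / 2)"
    by (intro continuous_intros continuous_on_compose2[OF Suc.IH])
       (use left_branch_in_unit in auto)
  have right: "continuous_on {1/2..1} (\<lambda>y. 1 - minkowski_approx k ((1 - y) / y) / 2)"
    by (intro continuous_intros continuous_on_compose2[OF Suc.IH])
       (use right_branch_in_unit in auto)
  have "continuous_on ({0..1/2} \<union> {1/2..1}) (\<lambda>y. if y \<le> 1/2
      then minkowski_approx k (y / (1 - y)) / 2 else 1 - minkowski_approx k ((1 - y) / y) / 2)"
  proof (intro continuous_on_If left right)
    show "minkowski_approx k (y / (1 - y)) / 2 = 1 - minkowski_approx k ((1 - y) / y) / 2"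
      if "y \<in> {1/2..1}" "y \<le> 1/2" for y
    proof -
      from that have "y = 1/2" by simp
      then show ?thesis by (simp only:) (simp add: minkowski_approx_1)
    qed
  qed auto
  moreover have "{0..1/2} \<union> {1/2..1} = {0..1::real}" by auto
  ultimately show ?case by simp
qed

lemma minkowski_approx_step:
  "y \<in> {0..1} \<Longrightarrow> \<bar>minkowski_approx (Suc k) y - minkowski_approx k y\<bar> \<le> (1/2) ^ k"
proof (induction k arbitrary: y)
  case 0
  have "minkowski_approx (Suc 0) y \<in> {0..1}"
    using minkowski_approx_mono[of 0 y "Suc 0"] minkowski_approx_mono[of y 1 "Suc 0"] 0
    by (simp add: minkowski_approx_0 minkowski_approx_1 del: minkowski_approx.simps)
  with 0 show ?case
    by (auto simp: abs_le_iff simp del: minkowski_approx.simps(2))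
next
  case (Suc k)
  show ?case
  proof (cases "y \<le> 1/2")
    case True
    then have "\<bar>minkowski_approx (Suc k) (y / (1 - y)) - minkowski_approx k (y / (1 - y))\<bar> \<le> (1/2) ^ k"
      using Suc.prems left_branch_in_unit[of y] by (intro Suc.IH) auto
    with True show ?thesis
      by (subst (1 2) minkowski_approx.simps(2)) (simp add: field_simps del: minkowski_approx.simps)
  next
    case False
    then have "\<bar>minkowski_approx (Suc k) ((1 - y) / y) - minkowski_approx k ((1 - y) / y)\<bar> \<le> (1/2) ^ k"
      using Suc.prems right_branch_in_unit[of y] by (intro Suc.IH) auto
    moreover have "\<bar>(1 - u / 2) - (1 - v / 2)\<bar> \<le> (1/2) ^ Suc k" if "\<bar>u - v\<bar> \<le> (1/2) ^ k" for u v :: real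
      using that unfolding abs_le_iff power_Suc by linarith
    ultimately show ?thesis
      using False by (simp only: minkowski_approx.simps(2)[of "Suc k" y] minkowski_approx.simps(2)[of k y] if_False)
  qed
qed

text \<open>
  The question mark function as the limit of these iterates; only its values on \<open>[0, 1]\<close> matter.
\<close>

definition minkowski :: "real \<Rightarrow> real" where
  "minkowski y = lim (\<lambda>k. minkowski_approx k y)"

lemma uniform_limit_minkowski: "uniform_limit {0..1} minkowski_approx minkowski sequentially"
proof -
  define d where "d k y = minkowski_approx (Suc k) y - minkowski_approx k y" for k y
  have "uniform_limit {0..1} (\<lambda>n y. \<Sum>k<n. d k y) (\<lambda>y. suminf (\<lambda>k. d k y)) sequentially"
    by (rule Weierstrass_m_test[where M = "\<lambda>k. (1/2) ^ k"])
       (auto simp: d_def simp del: minkowski_approx.simps intro!: minkowski_approx_step)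
  then have "uniform_limit {0..1} (\<lambda>n y. (\<Sum>k<n. d k y) + y) (\<lambda>y. suminf (\<lambda>k. d k y) + y) sequentially"
    by (intro uniform_limit_add uniform_limit_const)
  moreover have "(\<Sum>k<n. d k y) + y = minkowski_approx n y" for n y
    unfolding d_def using sum_lessThan_telescope[of "\<lambda>k. minkowski_approx k y" n] by simp
  ultimately have lim: "uniform_limit {0..1} minkowski_approx (\<lambda>y. suminf (\<lambda>k. d k y) + y) sequentially"
    by simp
  then have "minkowski y = suminf (\<lambda>k. d k y) + y" if "y \<in> {0..1}" for y
    unfolding minkowski_def using tendsto_uniform_limitI[OF lim that] by (simp add: limI)
  with lim show ?thesis
    by (subst uniform_limit_cong'[of "{0..1}" _ minkowski_approx]) auto
qed

lemma minkowski_approx_tendsto: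
  "0 \<le> y \<Longrightarrow> y \<le> 1 \<Longrightarrow> (\<lambda>k. minkowski_approx k y) \<longlonglongrightarrow> minkowski y"
  using tendsto_uniform_limitI[OF uniform_limit_minkowski] by simp

lemma continuous_on_minkowski: "continuous_on {0..1} minkowski"
  by (rule uniform_limit_theorem[OF _ uniform_limit_minkowski])
     (auto simp: continuous_on_minkowski_approx)

lemma minkowski_0 [simp]: "minkowski 0 = 0"
  by (simp add: minkowski_def minkowski_approx_0)

lemma minkowski_1 [simp]: "minkowski 1 = 1"
  by (simp add: minkowski_def minkowski_approx_1)

lemma minkowski_mono: "0 \<le> y \<Longrightarrow> y \<le> z \<Longrightarrow> z \<le> 1 \<Longrightarrow> minkowski y \<le> minkowski z"
  by (rule LIMSEQ_le[OF minkowski_approx_tendsto minkowski_approx_tendsto])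
     (auto intro: minkowski_approx_mono)

lemma minkowski_left: "0 \<le> z \<Longrightarrow> z \<le> 1 \<Longrightarrow> minkowski (z / (1 + z)) = minkowski z / 2"
proof -
  assume z: "0 \<le> z" "z \<le> 1"
  have "z / (1 + z) \<le> 1/2" "z / (1 + z) / (1 - z / (1 + z)) = z"
    using z by (auto simp: field_simps)
  then have "minkowski_approx (Suc k) (z / (1 + z)) = minkowski_approx k z / 2" for k
    by simp
  moreover have "(\<lambda>k. minkowski_approx (Suc k) (z / (1 + z))) \<longlonglongrightarrow> minkowski (z / (1 + z))"
    using z by (intro LIMSEQ_Suc minkowski_approx_tendsto) (auto simp: field_simps)
  moreover have "(\<lambda>k. minkowski_approx k z / 2) \<longlonglongrightarrow> minkowski z / 2"
    using z by (intro tendsto_intros minkowski_approx_tendsto) auto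
  ultimately show ?thesis
    by (simp only: LIMSEQ_unique)
qed

lemma minkowski_right: "0 \<le> z \<Longrightarrow> z \<le> 1 \<Longrightarrow> minkowski (1 / (1 + z)) = 1 - minkowski z / 2"
proof -
  assume z: "0 \<le> z" "z \<le> 1"
  have "minkowski_approx (Suc k) (1 / (1 + z)) = 1 - minkowski_approx k z / 2" for k
  proof (cases "z = 1")
    case True
    then show ?thesis by (simp add: minkowski_approx_1)
  next
    case False
    with z have "\<not> 1 / (1 + z) \<le> 1/2" "(1 - 1 / (1 + z)) / (1 / (1 + z)) = z"
      by (auto simp: field_simps)
    then show ?thesis by simp
  qed
  moreover have "(\<lambda>k. minkowski_approx (Suc k) (1 / (1 + z))) \<longlonglongrightarrow> minkowski (1 / (1 + z))"
    using z by (intro LIMSEQ_Suc minkowski_approx_tendsto) (auto simp: field_simps)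
  moreover have "(\<lambda>k. 1 - minkowski_approx k z / 2) \<longlonglongrightarrow> 1 - minkowski z / 2"
    using z by (intro tendsto_intros minkowski_approx_tendsto) auto
  ultimately show ?thesis
    by (simp only: LIMSEQ_unique)
qed

lemma minkowski_inverse_add:
  assumes "0 < n" "0 \<le> z" "z \<le> 1"
  shows "minkowski (1 / (real n + z)) = (2 - minkowski z) / 2 ^ n"
  using assms(1)
proof (induction n rule: nat_induct_non_zero)
  case 1
  then show ?case using assms minkowski_right[of z] by (simp add: field_simps)
next
  case (Suc n)
  have "1 / (real (Suc n) + z) = 1 / (real n + z) / (1 + 1 / (real n + z))"
    using Suc assms by (simp add: field_simps)
  also have "minkowski \<dots> = minkowski (1 / (real n + z)) / 2"
    using Suc.hyps assms by (intro minkowski_left) (auto simp: field_simps)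
  finally show ?case using Suc.IH by simp
qed

section \<open>Continued fractions with a real tail\<close>

text \<open>
  The finite continued fraction \<open>[b\<^sub>1, \<dots>, b\<^sub>k + z]\<close> with a real tail \<open>z\<close>; without partial quotients
  it is \<open>z\<close> itself.
\<close>

primrec cf_tail :: "nat list \<Rightarrow> real \<Rightarrow> real" where
  "cf_tail [] z = z"
| "cf_tail (b # bs) z = 1 / (real b + cf_tail bs z)"

text \<open>The list of the first \<open>n\<close> partial quotients \<open>a 1, \<dots>, a n\<close>.\<close>

abbreviation cf_prefix :: "(nat \<Rightarrow> nat) \<Rightarrow> nat \<Rightarrow> nat list" where
  "cf_prefix a n \<equiv> map a [1..<Suc n]"

lemma cf_tail_0: "cf_tail bs 0 = cf_value bs"
  by (induction bs) auto

lemma cf_tail_snoc: "cf_tail (bs @ [b]) z = cf_tail bs (1 / (real b + z))"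
  by (induction bs) auto

lemma cf_tail_in_unit:
  "\<forall>b\<in>set bs. b > 0 \<Longrightarrow> 0 \<le> z \<Longrightarrow> z \<le> 1 \<Longrightarrow> 0 \<le> cf_tail bs z \<and> cf_tail bs z \<le> 1"
proof (induction bs)
  case (Cons b bs)
  then have "0 \<le> cf_tail bs z" "1 \<le> real b" by auto
  then show ?case by (simp add: field_simps)
qed simp

text \<open>
  The function maps the set of numbers with prescribed first partial quotients to a dyadic interval,
  and there it is an affine image of the whole function.
\<close>

lemma minkowski_cf_tail:
  assumes "\<forall>b\<in>set bs. b > 0" "0 \<le> z" "z \<le> 1"
  shows "minkowski (cf_tail bs z) =
           minkowski (cf_value bs) + (-1) ^ length bs / 2 ^ sum_list bs * minkowski z"
  using assms(1)
proof (induction bs)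
  case (Cons b bs)
  have 1: "minkowski (cf_tail (b # bs) z) = (2 - minkowski (cf_tail bs z)) / 2 ^ b"
    unfolding cf_tail.simps
    using Cons.prems assms cf_tail_in_unit[of bs z] by (intro minkowski_inverse_add) auto
  have 2: "minkowski (cf_value (b # bs)) = (2 - minkowski (cf_value bs)) / 2 ^ b"
    unfolding cf_value.simps
    using Cons.prems cf_tail_in_unit[of bs 0] by (intro minkowski_inverse_add) (auto simp: cf_tail_0)
  have 3: "minkowski (cf_tail bs z) =
      minkowski (cf_value bs) + (-1) ^ length bs / 2 ^ sum_list bs * minkowski z"
    using Cons by simp
  show ?case
    unfolding 1 2 3 by (simp add: field_simps power_add)
qed simp

lemma minkowski_cf_value_dyadic:
  "\<forall>b\<in>set bs. b > 0 \<Longrightarrow> \<exists>m::int. minkowski (cf_value bs) = of_int m / 2 ^ sum_list bs"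
proof (induction bs)
  case Nil
  show ?case by (rule exI[of _ 0]) simp
next
  case (Cons b bs)
  then obtain m :: int where m: "minkowski (cf_value bs) = of_int m / 2 ^ sum_list bs"
    by auto
  have "minkowski (cf_value (b # bs)) = (2 - minkowski (cf_value bs)) / 2 ^ b"
    unfolding cf_value.simps
    using Cons.prems cf_tail_in_unit[of bs 0] by (intro minkowski_inverse_add) (auto simp: cf_tail_0)
  also have "\<dots> = of_int (2 * 2 ^ sum_list bs - m) / 2 ^ sum_list (b # bs)"
    by (simp add: m field_simps power_add)
  finally show ?case by blast
qed

lemma minkowski_cf_value_snoc:
  assumes "\<forall>b\<in>set bs. b > 0" "b > 0"
  shows "minkowski (cf_value (bs @ [b])) =
           minkowski (cf_value bs) + (-1) ^ length bs / 2 ^ (sum_list bs + b - 1)"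
proof -
  have "minkowski (1 / real b) = 2 / 2 ^ b"
    using minkowski_inverse_add[of b 0] assms by simp
  moreover have "2 ^ (sum_list bs + b) = (2::real) * 2 ^ (sum_list bs + b - 1)"
    using assms by (simp flip: power_Suc)
  ultimately show ?thesis
    using minkowski_cf_tail[of bs "1 / real b"] assms
    by (simp flip: cf_tail_0 add: cf_tail_snoc power_add)
qed

lemma question_mark_finite_eq:
  "\<forall>b\<in>set bs. b > 0 \<Longrightarrow> question_mark_finite bs = minkowski (cf_value bs)"
proof (induction bs rule: rev_induct)
  case Nil
  then show ?case by (simp add: question_mark_finite_def)
next
  case (snoc b bs)
  have "question_mark_finite (bs @ [b]) =
          question_mark_finite bs + (-1) ^ length bs / 2 ^ (sum_list bs + b - 1)"
    by (simp add: question_mark_finite_def)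
  then show ?case
    using snoc by (simp add: minkowski_cf_value_snoc)
qed

lemma sum_list_cf_prefix: "sum_list (cf_prefix a n) = (\<Sum>i=1..n. a i)"
  by (induction n) auto

lemma cf_prefix_pos: "\<forall>n\<ge>1. a n > 0 \<Longrightarrow> \<forall>b\<in>set (cf_prefix a n). b > 0"
  by auto

lemma question_mark_infinite_eq:
  assumes "is_infinite_cf a x"
  shows "0 \<le> x" "x \<le> 1" "question_mark_infinite a = minkowski x"
proof -
  have pos: "\<forall>n\<ge>1. a n > 0" and lim: "(\<lambda>n. cf_value (cf_prefix a n)) \<longlonglongrightarrow> x"
    using assms by (auto simp: is_infinite_cf_def)
  have unit: "cf_value (cf_prefix a n) \<in> {0..1}" for n
    using cf_tail_in_unit[OF cf_prefix_pos[OF pos], of 0 n] by (simp add: cf_tail_0)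
  have "x \<in> {0..1}"
    using closed_sequentially[OF _ _ lim, of "{0..1}"] unit by blast
  then show "0 \<le> x" "x \<le> 1" by auto
  have "(\<Sum>k<n. (-1) ^ (Suc k + 1) / 2 ^ ((\<Sum>i=1..Suc k. a i) - 1)) =
          minkowski (cf_value (cf_prefix a n))" for n
  proof (induction n)
    case (Suc n)
    have snoc: "cf_prefix a (Suc n) = cf_prefix a n @ [a (Suc n)]" by simp
    have "minkowski (cf_value (cf_prefix a (Suc n))) = minkowski (cf_value (cf_prefix a n)) +
        (-1) ^ n / 2 ^ ((\<Sum>i=1..Suc n. a i) - 1)"
      using minkowski_cf_value_snoc[OF cf_prefix_pos[OF pos], of "a (Suc n)" n] pos
      unfolding sum_list_cf_prefix snoc by (simp del: upt_Suc)
    with Suc show ?case by simp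
  qed simp
  moreover have "(\<lambda>n. minkowski (cf_value (cf_prefix a n))) \<longlonglongrightarrow> minkowski x"
    using continuous_on_tendsto_compose[OF continuous_on_minkowski lim \<open>x \<in> {0..1}\<close>] unit by simp
  ultimately have "(\<lambda>k. (-1) ^ (Suc k + 1) / 2 ^ ((\<Sum>i=1..Suc k. a i) - 1)) sums minkowski x"
    by (simp add: sums_def)
  then show "question_mark_infinite a = minkowski x"
    unfolding question_mark_infinite_def by (rule sums_unique[symmetric])
qed

section \<open>Convergents\<close>

text \<open>
  Numerators and denominators of the convergents of \<open>a\<close>, with the index shifted by one:
  \<open>cf_num a (Suc n) / cf_den a (Suc n)\<close> is the \<open>n\<close>-th convergent \<open>[a 1, \<dots>, a n]\<close>, and index \<open>0\<close>
  stands for the formal convergent \<open>1 / 0\<close> that starts the recursion.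
\<close>

fun cf_num :: "(nat \<Rightarrow> nat) \<Rightarrow> nat \<Rightarrow> nat" where
  "cf_num a 0 = 1"
| "cf_num a (Suc 0) = 0"
| "cf_num a (Suc (Suc n)) = a (Suc n) * cf_num a (Suc n) + cf_num a n"

fun cf_den :: "(nat \<Rightarrow> nat) \<Rightarrow> nat \<Rightarrow> nat" where
  "cf_den a 0 = 0"
| "cf_den a (Suc 0) = 1"
| "cf_den a (Suc (Suc n)) = a (Suc n) * cf_den a (Suc n) + cf_den a n"

lemma cf_den_pos: "\<forall>n\<ge>1. a n > 0 \<Longrightarrow> cf_den a (Suc n) > 0"
  by (induction n) auto

lemma cf_den_mono: "\<forall>n\<ge>1. a n > 0 \<Longrightarrow> cf_den a n \<le> cf_den a (Suc n)"
  by (cases n) (auto simp: Suc_le_eq intro!: trans_le_add1)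

lemma cf_den_ge: "\<forall>n\<ge>1. a n > 0 \<Longrightarrow> n \<le> cf_den a (Suc n)"
proof (induction n)
  case (Suc n)
  show ?case
  proof (cases n)
    case 0
    with Suc.prems show ?thesis by (simp add: Suc_le_eq)
  next
    case (Suc m)
    have "cf_den a (Suc n) \<le> a (Suc n) * cf_den a (Suc n)" using Suc.prems by (auto simp: Suc_le_eq)
    moreover have "cf_den a n \<ge> 1" using cf_den_pos[OF Suc.prems, of m] Suc by simp
    moreover have "n \<le> cf_den a (Suc n)" using Suc.IH Suc.prems .
    ultimately show ?thesis unfolding cf_den.simps by linarith
  qed
qed simp

lemma cf_det:
  "real (cf_num a n) * real (cf_den a (Suc n)) - real (cf_num a (Suc n)) * real (cf_den a n) = (-1) ^ n"
proof (induction n)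
  case (Suc n)
  then show ?case by (simp add: algebra_simps)
qed simp

lemma cf_tail_prefix:
  assumes "\<forall>n\<ge>1. a n > 0" "z \<ge> 0"
  shows "cf_tail (cf_prefix a n) z =
    (real (cf_num a (Suc n)) + real (cf_num a n) * z) / (real (cf_den a (Suc n)) + real (cf_den a n) * z)"
  using assms(2)
proof (induction n arbitrary: z)
  case (Suc n)
  have a: "0 < real (a (Suc n)) + z" using assms(1) Suc.prems by (simp add: add_pos_nonneg)
  have "cf_tail (cf_prefix a (Suc n)) z = cf_tail (cf_prefix a n) (1 / (real (a (Suc n)) + z))"
    using cf_tail_snoc[of "cf_prefix a n"] by simp
  also have "\<dots> = (real (cf_num a (Suc n)) + real (cf_num a n) * (1 / (real (a (Suc n)) + z))) /
      (real (cf_den a (Suc n)) + real (cf_den a n) * (1 / (real (a (Suc n)) + z)))"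
    using a by (intro Suc.IH) simp
  also have "\<dots> = (real (cf_num a (Suc (Suc n))) + real (cf_num a (Suc n)) * z) /
      (real (cf_den a (Suc (Suc n))) + real (cf_den a (Suc n)) * z)"
  proof -
    have e: "u + v * (1 / (real (a (Suc n)) + z)) = ((real (a (Suc n)) * u + v) + u * z) / (real (a (Suc n)) + z)"
      for u v using a by (simp add: field_simps)
    have cancel: "(u / w) / (v / w) = u / v" if "w > 0" for u v w :: real
      using that by simp
    show ?thesis unfolding e cancel[OF a] by simp
  qed
  finally show ?case .
qed simp

lemma cf_tail_minus_value:
  assumes "\<forall>n\<ge>1. a n > 0" "z \<ge> 0"
  shows "cf_tail (cf_prefix a n) z - cf_value (cf_prefix a n) =
    (-1) ^ n * (z / (real (cf_den a (Suc n)) * (real (cf_den a (Suc n)) + real (cf_den a n) * z)))"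
proof -
  define p p' q q' where "p = real (cf_num a (Suc n))" "p' = real (cf_num a n)"
    "q = real (cf_den a (Suc n))" "q' = real (cf_den a n)"
  have pos: "q > 0" "q + q' * z > 0"
    using cf_den_pos[OF assms(1), of n] assms(2) by (auto simp: p_p'_q_q'_def add_pos_nonneg)
  have "cf_tail (cf_prefix a n) z - cf_value (cf_prefix a n) = (p + p' * z) / (q + q' * z) - p / q"
    using cf_tail_prefix[OF assms(1), of _ n] assms(2) by (simp add: p_p'_q_q'_def flip: cf_tail_0)
  also have "\<dots> = (p' * q - p * q') * (z / (q * (q + q' * z)))"
    using pos by (simp add: field_simps)
  finally show ?thesis
    using cf_det[of a n] by (simp add: p_p'_q_q'_def)
qed

section \<open>Existence of expansions and agreement of the two definitions\<close>

lemma finite_cf_exists: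
  fixes p q :: nat
  assumes "0 < p" "p \<le> q"
  shows "\<exists>bs. is_finite_cf bs (real p / real q)"
  using assms
proof (induction p arbitrary: q rule: less_induct)
  case (less p)
  \<comment> \<open>one step of the Euclidean algorithm\<close>
  define b r where "b = q div p" "r = q mod p"
  have b: "b > 0" using less.prems by (simp add: b_r_def div_greater_zero_iff)
  have q: "real q = real b * real p + real r"
    using div_mult_mod_eq[of q p] by (simp add: b_r_def flip: of_nat_mult of_nat_add)
  have "r < p" using less.prems by (simp add: b_r_def)
  show ?case
  proof (cases "r = 0")
    case True
    then have "is_finite_cf [b] (real p / real q)"
      using b q less.prems by (simp add: is_finite_cf_def)
    then show ?thesis by blast
  next
    case False
    then obtain bs where bs: "is_finite_cf bs (real r / real p)"
      using less.IH[of r p] \<open>r < p\<close> by auto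
    have "1 / (real b + real r / real p) = real p / real q"
      using q less.prems by (simp add: field_simps)
    with bs b have "is_finite_cf (b # bs) (real p / real q)"
      by (auto simp: is_finite_cf_def)
    then show ?thesis by blast
  qed
qed

lemma infinite_cf_exists:
  assumes "y \<notin> \<rat>" "0 < y" "y < 1"
  shows "\<exists>a. is_infinite_cf a y"
proof -
  \<comment> \<open>the orbit of the Gauss map, which consists of the tails of the expansion\<close>
  define t where "t n = ((\<lambda>z. frac (1 / z)) ^^ n) y" for n
  define a where "a n = nat \<lfloor>1 / t (n - 1)\<rfloor>" for n
  have t_Suc: "t (Suc n) = frac (1 / t n)" for n by (simp add: t_def)
  have t: "t n \<notin> \<rat> \<and> 0 < t n \<and> t n < 1" for n
  proof (induction n)
    case 0
    then show ?case using assms by (simp add: t_def)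
  next
    case (Suc n)
    have "1 / t n \<notin> \<rat>"
    proof
      assume "1 / t n \<in> \<rat>"
      then have "1 / (1 / t n) \<in> \<rat>" by (rule Rats_divide[OF Rats_1])
      with Suc show False by simp
    qed
    then have "t (Suc n) \<notin> \<rat>"
      unfolding t_Suc frac_def using Rats_add[of "1 / t n - of_int \<lfloor>1 / t n\<rfloor>" "of_int \<lfloor>1 / t n\<rfloor>"] by auto
    moreover from this have "t (Suc n) \<noteq> 0" by auto
    ultimately show ?case
      using frac_ge_0[of "1 / t n"] frac_lt_1[of "1 / t n"] by (simp add: t_Suc)
  qed
  have a_pos: "a (Suc n) > 0" and t_eq: "1 / (real (a (Suc n)) + t (Suc n)) = t n" for n
  proof -
    have "1 / t n > 1" using t[of n] by simp
    then have fl: "\<lfloor>1 / t n\<rfloor> \<ge> 1" by linarith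
    then show "a (Suc n) > 0" by (simp add: a_def)
    have "real (a (Suc n)) + t (Suc n) = 1 / t n"
      using fl by (simp add: a_def t_Suc frac_def del: one_le_floor)
    then show "1 / (real (a (Suc n)) + t (Suc n)) = t n" by simp
  qed
  have pos: "\<forall>n\<ge>1. a n > 0"
  proof (intro allI impI)
    show "a n > 0" if "n \<ge> 1" for n using a_pos[of "n - 1"] that by simp
  qed
  have y: "cf_tail (cf_prefix a n) (t n) = y" for n
  proof (induction n)
    case 0
    then show ?case by (simp add: t_def)
  next
    case (Suc n)
    have "cf_prefix a (Suc n) = cf_prefix a n @ [a (Suc n)]" by simp
    then show ?case
      by (simp only: cf_tail_snoc t_eq Suc.IH)
  qed
  \<comment> \<open>convergence, since the denominators tend to infinity\<close>
  have "\<bar>cf_value (cf_prefix a n) - y\<bar> \<le> inverse (real n)" if "n > 0" for n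
  proof -
    define q where "q = real (cf_den a (Suc n))"
    have q: "q \<ge> real n" "q \<ge> 1"
      using cf_den_ge[OF pos, of n] cf_den_pos[OF pos, of n] by (auto simp: q_def)
    define d where "d = q + real (cf_den a n) * t n"
    have d: "d \<ge> q" using t[of n] by (simp add: d_def)
    have "\<bar>y - cf_value (cf_prefix a n)\<bar> = t n / (q * d)"
    proof -
      have "y - cf_value (cf_prefix a n) = (-1) ^ n * (t n / (q * d))"
        using cf_tail_minus_value[OF pos, of "t n" n] t[of n] unfolding y q_def d_def by simp
      then show ?thesis using t[of n] q d by (simp only: abs_mult) simp
    qed
    also have "\<dots> \<le> 1 / (real n * 1)"
      using t[of n] q d that by (intro frac_le mult_mono) auto
    finally show ?thesis by (simp add: abs_minus_commute inverse_eq_divide)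
  qed
  then have "eventually (\<lambda>n. norm (cf_value (cf_prefix a n) - y) \<le> inverse (real n)) sequentially"
    unfolding real_norm_def eventually_sequentially by (intro exI[of _ 1]) (simp del: upt_Suc)
  then have "(\<lambda>n. cf_value (cf_prefix a n) - y) \<longlonglongrightarrow> 0"
    by (rule Lim_null_comparison) (rule lim_inverse_n)
  then have "(\<lambda>n. cf_value (cf_prefix a n)) \<longlonglongrightarrow> y"
    by (rule LIM_zero_cancel)
  with pos show ?thesis unfolding is_infinite_cf_def by blast
qed

lemma question_mark_eq_minkowski:
  assumes "0 < y" "y < 1"
  shows "question_mark y = minkowski y"
proof (cases "y \<in> \<rat>")
  case True
  then obtain p q :: nat where pq: "q \<noteq> 0" "\<bar>y\<bar> = real p / real q"
    by (rule Rats_abs_nat_div_natE)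
  then have "y = real p / real q" using assms by simp
  moreover from this have "0 < p" "p \<le> q"
    using assms pq(1) by (auto simp: divide_less_eq_1 zero_less_divide_iff)
  ultimately have "\<exists>bs. is_finite_cf bs y"
    using finite_cf_exists by blast
  then have "is_finite_cf (SOME bs. is_finite_cf bs y) y"
    by (rule someI_ex)
  with True assms show ?thesis
    by (simp add: question_mark_def is_finite_cf_def question_mark_finite_eq)
next
  case False
  then have "\<exists>a. is_infinite_cf a y"
    using infinite_cf_exists assms by blast
  then have "is_infinite_cf (SOME a. is_infinite_cf a y) y"
    by (rule someI_ex)
  with False assms show ?thesis
    by (simp add: question_mark_def question_mark_infinite_eq)
qed

lemma fixed_points_eq: "fixed_points = {x. 0 < x \<and> x < 1/2 \<and> minkowski x = x}"
  by (auto simp: fixed_points_def question_mark_eq_minkowski)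

section \<open>Tails of infinite expansions\<close>

lemma infinite_cf_head:
  assumes "is_infinite_cf a x"
  obtains z where "is_infinite_cf (\<lambda>n. a (Suc n)) z" "0 \<le> z" "z \<le> 1" "x = 1 / (real (a 1) + z)"
proof -
  define c where "c n = cf_value (cf_prefix (\<lambda>n. a (Suc n)) n)" for n
  have pos: "\<forall>n\<ge>1. a n > 0" and lim: "(\<lambda>n. cf_value (cf_prefix a n)) \<longlonglongrightarrow> x"
    using assms by (auto simp: is_infinite_cf_def)
  have "cf_prefix a (Suc n) = a 1 # cf_prefix (\<lambda>n. a (Suc n)) n" for n
  proof -
    have "[1..<Suc (Suc n)] = 1 # map Suc [1..<Suc n]"
      by (subst upt_conv_Cons) (simp_all add: map_Suc_upt del: upt_Suc)
    then show ?thesis by (simp only: list.map map_map comp_def)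
  qed
  then have cf_Suc: "cf_value (cf_prefix a (Suc n)) = 1 / (real (a 1) + c n)" for n
    by (simp only: cf_value.simps c_def)
  have unit: "c n \<in> {0..1}" for n
    using cf_tail_in_unit[OF cf_prefix_pos, of "\<lambda>n. a (Suc n)" 0 n] pos
    by (simp add: cf_tail_0 c_def del: upt_Suc)
  have a1: "real (a 1) \<ge> 1" using pos by (simp add: Suc_le_eq)
  have lim': "(\<lambda>n. 1 / (real (a 1) + c n)) \<longlonglongrightarrow> x"
    using LIMSEQ_Suc[OF lim] unfolding cf_Suc .
  have "1 / (real (a 1) + 1) \<le> x"
  proof (rule LIMSEQ_le_const[OF lim'], intro exI[of _ 0] allI impI)
    show "1 / (real (a 1) + 1) \<le> 1 / (real (a 1) + c n)" for n
      using unit[of n] a1 by (intro divide_left_mono mult_pos_pos) auto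
  qed
  moreover have "0 < 1 / (real (a 1) + 1)" using a1 by simp
  ultimately have "x > 0" by linarith
  have "(\<lambda>n. 1 / (1 / (real (a 1) + c n)) - real (a 1)) \<longlonglongrightarrow> 1 / x - real (a 1)"
    using \<open>x > 0\<close> by (intro tendsto_intros lim') auto
  then have limc: "c \<longlonglongrightarrow> 1 / x - real (a 1)" by simp
  then have "is_infinite_cf (\<lambda>n. a (Suc n)) (1 / x - real (a 1))"
    using pos unfolding is_infinite_cf_def c_def by simp
  moreover have "1 / x - real (a 1) \<in> {0..1}"
    using closed_sequentially[OF _ _ limc, of "{0..1}"] unit by blast
  moreover have "x = 1 / (real (a 1) + (1 / x - real (a 1)))" by simp
  ultimately show ?thesis using that by auto
qed

lemma infinite_cf_tail:
  assumes "is_infinite_cf a x"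
  obtains t where "1 / (real (a (Suc n)) + 1) \<le> t" "t \<le> 1 / real (a (Suc n))"
    "x = cf_tail (cf_prefix a n) t"
proof -
  have pos: "\<forall>n\<ge>1. a n > 0" using assms by (simp add: is_infinite_cf_def)
  have "\<exists>t. is_infinite_cf (\<lambda>k. a (n + k)) t \<and> x = cf_tail (cf_prefix a n) t"
  proof (induction n)
    case 0
    then show ?case using assms by auto
  next
    case (Suc n)
    then obtain t where t: "is_infinite_cf (\<lambda>k. a (n + k)) t" "x = cf_tail (cf_prefix a n) t"
      by blast
    from t(1) obtain z where z: "is_infinite_cf (\<lambda>k. a (n + Suc k)) z" "t = 1 / (real (a (n + 1)) + z)"
      by (rule infinite_cf_head)
    have "cf_prefix a (Suc n) = cf_prefix a n @ [a (n + 1)]" by simp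
    then have "x = cf_tail (cf_prefix a (Suc n)) z"
      by (simp only: cf_tail_snoc t z)
    with z show ?case by auto
  qed
  then obtain t where t: "is_infinite_cf (\<lambda>k. a (n + k)) t" "x = cf_tail (cf_prefix a n) t"
    by blast
  from t(1) obtain z where "0 \<le> z" "z \<le> 1" "t = 1 / (real (a (n + 1)) + z)"
    by (rule infinite_cf_head)
  moreover from this pos have "1 / (real (a (n + 1)) + 1) \<le> t" "t \<le> 1 / (real (a (n + 1)) + 0)"
    by (auto simp: add_pos_nonneg intro!: divide_left_mono mult_pos_pos)
  ultimately show ?thesis using that t by simp
qed

text \<open>
  An enclosure \<open>m \<le> 1 / u < 1 / x < 1 / l \<le> m + 1\<close> determines the first partial quotient and passes an
  enclosure on to the tail.
\<close>

lemma infinite_cf_digit: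
  assumes "is_infinite_cf a x" "l < x" "x < u" "0 < l" "1 / l \<le> real m + 1" "real m \<le> 1 / u"
  shows "a 1 = m \<and> (\<exists>z. is_infinite_cf (\<lambda>n. a (Suc n)) z \<and> 1 / u - real m < z \<and> z < 1 / l - real m)"
proof -
  obtain z where z: "is_infinite_cf (\<lambda>n. a (Suc n)) z" "0 \<le> z" "z \<le> 1" "x = 1 / (real (a 1) + z)"
    using assms(1) by (rule infinite_cf_head)
  have inv: "1 / x = real (a 1) + z" using z by simp
  have "1 / u < 1 / x" "1 / x < 1 / l"
    using assms by (auto intro!: divide_strict_left_mono)
  with inv assms(5,6) z(2,3) have "a 1 = m" by linarith
  moreover from this inv \<open>1 / u < 1 / x\<close> \<open>1 / x < 1 / l\<close> have "1 / u - real m < z" "z < 1 / l - real m"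
    by linarith+
  ultimately show ?thesis using z(1) by blast
qed

section \<open>Location of the fixed points\<close>

lemma minkowski_cf_eval:
  assumes "\<forall>b\<in>set bs. b > 0" "cf_value bs = r" "foldr (\<lambda>b v. (2 - v) / 2 ^ b) bs 0 = v"
  shows "minkowski r = v"
proof -
  have "minkowski (cf_value bs) = foldr (\<lambda>b v. (2 - v) / 2 ^ b) bs 0"
    using assms(1)
  proof (induction bs)
    case (Cons b bs)
    then show ?case
      using minkowski_inverse_add[of b "cf_value bs"] cf_tail_in_unit[of bs 0]
      by (simp add: cf_tail_0)
  qed simp
  with assms show ?thesis by simp
qed

text \<open>
  The bound \<open>2 * w / (2 + w)\<close> is slightly stronger than \<open>minkowski w < w\<close>. Under \<open>y = 1 / (2 + w)\<close> it
  becomes \<open>y < minkowski y\<close>, so that it controls the function near \<open>0\<close> and just below \<open>1/2\<close> alike. It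
  is proved on \<open>[1/4, 1/3]\<close> directly and pulled back to \<open>(0, 1/4]\<close> along \<open>w \<mapsto> w / (1 - w)\<close>.
\<close>

lemma minkowski_near_0:
  assumes "0 < w" "w \<le> 1/3"
  shows "minkowski w < 2 * w / (2 + w)"
proof -
  have "minkowski w < 2 * w / (2 + w)" if "1 / (real n + 4) \<le> w" "w \<le> 1/3" for n w
    using that
  proof (induction n arbitrary: w)
    case 0
    show ?case
    proof (cases "w \<le> 2/7")
      case True
      have "minkowski (2/7) = 3/16" by (rule minkowski_cf_eval[of "[3,2]"]) simp_all
      then have "minkowski w \<le> 3/16" using minkowski_mono[of w "2/7"] 0 True by simp
      also have "3/16 < 2 * w / (2 + w)" using 0 by (simp add: field_simps)
      finally show ?thesis .
    next
      case False
      have "minkowski (1/3) = 1/4" by (rule minkowski_cf_eval[of "[3]"]) simp_all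
      then have "minkowski w \<le> 1/4" using minkowski_mono[of w "1/3"] 0 by simp
      also have "1/4 < 2 * w / (2 + w)" using 0 False by (simp add: field_simps)
      finally show ?thesis .
    qed
  next
    case (Suc n)
    have w: "0 < w" using Suc.prems(1) by (rule less_le_trans[rotated]) simp
    show ?case
    proof (cases "w \<le> 1/4")
      case True
      define z where "z = w / (1 - w)"
      have z: "0 < z" "z \<le> 1/3" "w = z / (1 + z)"
        using True w by (auto simp: z_def field_simps)
      have "1 / (real n + 4) \<le> z"
        using Suc.prems(1) True w by (simp add: z_def field_simps)
      then have "minkowski z < 2 * z / (2 + z)" using Suc.IH z by blast
      then have "minkowski w < z / (2 + z)"
        using z minkowski_left[of z] by simp
      also have "\<dots> \<le> 2 * w / (2 + w)"
      proof -
        have "2 + w = (2 + 3 * z) / (1 + z)"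
          using z(1) by (simp add: z(3) field_simps)
        then have "2 * w / (2 + w) = 2 * z / (2 + 3 * z)"
          using z(1) by (simp add: z(3))
        moreover have "z / (2 + z) \<le> 2 * z / (2 + 3 * z)"
          using z(1,2) by (simp add: field_simps)
        ultimately show ?thesis by simp
      qed
      finally show ?thesis .
    next
      case False
      have "1 / (real n + 4) \<le> 1/4" by (simp add: field_simps)
      with False have "1 / (real n + 4) \<le> w" by linarith
      then show ?thesis using Suc.IH Suc.prems(2) by blast
    qed
  qed
  moreover obtain n :: nat where "1 / w < real n" using reals_Archimedean2 by blast
  then have "1 / (real n + 4) \<le> w" using assms by (simp add: field_simps)
  ultimately show ?thesis using assms by blast
qed

text \<open>
  On an interval at whose far end the function has not yet reached (or has already passed) the near
  end, monotonicity excludes fixed points. A chain of such intervals is used on each side.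
\<close>

lemma minkowski_less_step:
  "minkowski v \<le> u \<Longrightarrow> u < y \<Longrightarrow> y \<le> v \<Longrightarrow> 0 \<le> u \<Longrightarrow> v \<le> 1 \<Longrightarrow> minkowski y < y"
  using minkowski_mono[of y v] by simp

lemma minkowski_greater_step:
  "v \<le> minkowski u \<Longrightarrow> u \<le> y \<Longrightarrow> y < v \<Longrightarrow> 0 \<le> u \<Longrightarrow> v \<le> 1 \<Longrightarrow> y < minkowski y"
  using minkowski_mono[of u y] by simp

lemma minkowski_less_left:
  assumes "0 < y" "y \<le> 29/69"
  shows "minkowski y < y"
proof -
  \<comment> \<open>division points \<open>v\<close> of the chain: \<open>minkowski v\<close> is at most the preceding division point, the first of which is \<open>1/3\<close>\<close>
  have v1: "minkowski (21/55) = 85/256" by (rule minkowski_cf_eval[of "[2,1,1,1,1,1,2]"]) simp_all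
  have v2: "minkowski (20/49) = 195/512" by (rule minkowski_cf_eval[of "[2,2,4,2]"]) simp_all
  have v3: "minkowski (28/67) = 417/1024" by (rule minkowski_cf_eval[of "[2,2,1,1,5]"]) simp_all
  have v4: "minkowski (34/81) = 213/512" by (rule minkowski_cf_eval[of "[2,2,1,1,1,1,2]"]) simp_all
  have v5: "minkowski (50/119) = 429/1024" by (rule minkowski_cf_eval[of "[2,2,1,1,1,2,2]"]) simp_all
  have v6: "minkowski (29/69) = 215/512" by (rule minkowski_cf_eval[of "[2,2,1,1,1,3]"]) simp_all
  consider "y \<le> 1/3" | "1/3 < y" "y \<le> 21/55" | "21/55 < y" "y \<le> 20/49" | "20/49 < y" "y \<le> 28/67"
    | "28/67 < y" "y \<le> 34/81" | "34/81 < y" "y \<le> 50/119" | "50/119 < y" "y \<le> 29/69"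
    using assms by linarith
  then show ?thesis
  proof cases
    case 1
    then have "minkowski y < 2 * y / (2 + y)" using assms by (intro minkowski_near_0)
    also have "\<dots> \<le> y" using assms by (simp add: field_simps)
    finally show ?thesis .
  next
    case 2 then show ?thesis by (rule minkowski_less_step[rotated]) (simp_all add: v1)
  next
    case 3 then show ?thesis by (rule minkowski_less_step[rotated]) (simp_all add: v2)
  next
    case 4 then show ?thesis by (rule minkowski_less_step[rotated]) (simp_all add: v3)
  next
    case 5 then show ?thesis by (rule minkowski_less_step[rotated]) (simp_all add: v4)
  next
    case 6 then show ?thesis by (rule minkowski_less_step[rotated]) (simp_all add: v5)
  next
    case 7 then show ?thesis by (rule minkowski_less_step[rotated]) (simp_all add: v6)
  qed
qed

lemma minkowski_greater_right:
  assumes "37/88 \<le> y" "y < 1/2"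
  shows "y < minkowski y"
proof -
  \<comment> \<open>division points \<open>u\<close> of the chain: \<open>minkowski u\<close> is at least the next division point to the right, the last of which is \<open>3/7\<close>\<close>
  have v1: "minkowski (41/97) = 439/1024" by (rule minkowski_cf_eval[of "[2,2,1,2,1,3]"]) simp_all
  have v2: "minkowski (35/83) = 433/1024" by (rule minkowski_cf_eval[of "[2,2,1,2,4]"]) simp_all
  have v3: "minkowski (8/19) = 27/64" by (rule minkowski_cf_eval[of "[2,2,1,2]"]) simp_all
  have v4: "minkowski (45/107) = 863/2048" by (rule minkowski_cf_eval[of "[2,2,1,1,1,5]"]) simp_all
  have v5: "minkowski (37/88) = 431/1024" by (rule minkowski_cf_eval[of "[2,2,1,1,1,4]"]) simp_all
  consider "3/7 \<le> y" | "41/97 \<le> y" "y < 3/7" | "35/83 \<le> y" "y < 41/97" | "8/19 \<le> y" "y < 35/83"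
    | "45/107 \<le> y" "y < 8/19" | "37/88 \<le> y" "y < 45/107"
    using assms by linarith
  then show ?thesis
  proof cases
    case 1
    define w where "w = 1 / y - 2"
    have w: "0 < w" "w \<le> 1/3" "y = 1 / (real 2 + w)"
      using 1 assms by (auto simp: w_def field_simps)
    have "minkowski y = 1/2 - minkowski w / 4"
      using w(1,2) minkowski_inverse_add[of 2 w] unfolding w(3) by simp
    moreover have "minkowski w < 2 * w / (2 + w)" using w by (intro minkowski_near_0)
    moreover have "2 * w / (2 + w) = 2 - 4 * y" using w(1) by (simp add: w(3) field_simps)
    ultimately show ?thesis by linarith
  next
    case 2 then show ?thesis by (rule minkowski_greater_step[rotated]) (simp_all add: v1)
  next
    case 3 then show ?thesis by (rule minkowski_greater_step[rotated]) (simp_all add: v2)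
  next
    case 4 then show ?thesis by (rule minkowski_greater_step[rotated]) (simp_all add: v3)
  next
    case 5 then show ?thesis by (rule minkowski_greater_step[rotated]) (simp_all add: v4)
  next
    case 6 then show ?thesis by (rule minkowski_greater_step[rotated]) (simp_all add: v5)
  qed
qed

lemma fixed_point_location:
  assumes "x \<in> fixed_points"
  shows "29/69 < x" "x < 37/88"
  using assms minkowski_less_left[of x] minkowski_greater_right[of x]
  by (auto simp: fixed_points_eq not_le[symmetric])

lemma fixed_point_first_digits:
  assumes "x \<in> fixed_points" "is_infinite_cf a x"
  shows "a 1 = 2" "a 2 = 2" "a 3 = 1" "a 4 = 1" "a 5 = 1" "a 6 = 3"
proof -
  have 1: "a 1 = 2 \<and> (\<exists>z. is_infinite_cf (\<lambda>n. a (Suc n)) z \<and> 14/37 < z \<and> z < 11/29)"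
    using infinite_cf_digit[OF assms(2) fixed_point_location[OF assms(1)], of 2] by simp
  then obtain z1 where z1: "is_infinite_cf (\<lambda>n. a (Suc n)) z1" "14/37 < z1" "z1 < 11/29" by blast
  from infinite_cf_digit[OF this, of 2]
  have 2: "a 2 = 2 \<and> (\<exists>z. is_infinite_cf (\<lambda>n. a (Suc (Suc n))) z \<and> 7/11 < z \<and> z < 9/14)"
    by (simp add: numeral_2_eq_2)
  then obtain z2 where z2: "is_infinite_cf (\<lambda>n. a (Suc (Suc n))) z2" "7/11 < z2" "z2 < 9/14" by blast
  from infinite_cf_digit[OF this, of 1]
  have 3: "a 3 = 1 \<and> (\<exists>z. is_infinite_cf (\<lambda>n. a (Suc (Suc (Suc n)))) z \<and> 5/9 < z \<and> z < 4/7)"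
    by (simp add: numeral_3_eq_3)
  then obtain z3 where z3: "is_infinite_cf (\<lambda>n. a (Suc (Suc (Suc n)))) z3" "5/9 < z3" "z3 < 4/7"
    by blast
  from infinite_cf_digit[OF this, of 1]
  have 4: "a 4 = 1 \<and> (\<exists>z. is_infinite_cf (\<lambda>n. a (Suc (Suc (Suc (Suc n))))) z \<and> 3/4 < z \<and> z < 4/5)"
    by (simp add: eval_nat_numeral)
  then obtain z4 where z4: "is_infinite_cf (\<lambda>n. a (Suc (Suc (Suc (Suc n))))) z4" "3/4 < z4" "z4 < 4/5"
    by blast
  from infinite_cf_digit[OF this, of 1]
  have 5: "a 5 = 1 \<and> (\<exists>z. is_infinite_cf (\<lambda>n. a (Suc (Suc (Suc (Suc (Suc n)))))) z \<and> 1/4 < z \<and> z < 1/3)"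
    by (simp add: eval_nat_numeral)
  then obtain z5 where z5: "is_infinite_cf (\<lambda>n. a (Suc (Suc (Suc (Suc (Suc n)))))) z5" "1/4 < z5" "z5 < 1/3"
    by blast
  from infinite_cf_digit[OF this, of 3] have 6: "a 6 = 3"
    by (simp add: eval_nat_numeral)
  show "a 1 = 2" "a 2 = 2" "a 3 = 1" "a 4 = 1" "a 5 = 1" "a 6 = 3"
    using 1 2 3 4 5 6 by blast+
qed

section \<open>Growth of the denominators\<close>

lemma cf_den_add_le:
  assumes pos: "\<forall>n\<ge>1. a n > 0"
  shows "cf_den a (Suc n) + cf_den a n \<le> 2 ^ (\<Sum>i=1..n. a i)"
proof (induction n)
  case (Suc n)
  define S where "S = (\<Sum>i=1..n. a i)"
  have "cf_den a (Suc (Suc n)) + cf_den a (Suc n) =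
      a (Suc n) * cf_den a (Suc n) + (cf_den a (Suc n) + cf_den a n)"
    by simp
  also have "\<dots> \<le> a (Suc n) * 2 ^ S + 2 ^ S"
    using Suc.IH unfolding S_def[symmetric] by (intro add_mono mult_left_mono) auto
  also have "\<dots> = Suc (a (Suc n)) * 2 ^ S" by simp
  also have "\<dots> \<le> 2 ^ a (Suc n) * 2 ^ S"
    using less_exp[of "a (Suc n)"] by (intro mult_right_mono) (auto simp: Suc_le_eq)
  finally show ?case by (simp add: S_def power_add mult.commute)
qed simp

lemma cf_den_less:
  assumes pos: "\<forall>n\<ge>1. a n > 0" and "n \<ge> 1"
  shows "cf_den a (Suc n) < 2 ^ (\<Sum>i=1..n. a i)"
  using cf_den_add_le[OF pos, of n] cf_den_pos[OF pos, of "n - 1"] assms(2) by simp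

text \<open>
  Denominators grow at most like \<open>(5/3) ^ S n\<close>. Any base \<open>L\<close> with \<open>1 + L \<le> L^2\<close> would do for the
  induction; what counts later is that \<open>(5/3)^2 < 4\<close>.
\<close>

lemma cf_den_growth:
  fixes C :: real
  assumes pos: "\<forall>n\<ge>1. a n > 0"
    and start: "real (cf_den a (Suc N)) \<le> C" "real (cf_den a (Suc N)) + real (cf_den a N) \<le> C * (5/3)"
    and "N \<le> n"
  shows "real (cf_den a (Suc n)) \<le> C * (5/3) ^ (\<Sum>i\<in>{N<..n}. a i) \<and>
    real (cf_den a (Suc n)) + real (cf_den a n) \<le> C * (5/3) ^ Suc (\<Sum>i\<in>{N<..n}. a i)"
  using \<open>N \<le> n\<close>
proof (induction n rule: dec_induct)
  case base
  then show ?case using start by simp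
next
  case (step n)
  define S b q q' where "S = (\<Sum>i\<in>{N<..n}. a i)" "b = a (Suc n)"
    "q = real (cf_den a (Suc n))" "q' = real (cf_den a n)"
  note defs = S_b_q_q'_def
  have sum: "(\<Sum>i\<in>{N<..Suc n}. a i) = S + b"
  proof -
    have "{N<..Suc n} = insert (Suc n) {N<..n}" using step.hyps by auto
    then show ?thesis by (simp add: defs)
  qed
  have IH: "q \<le> C * (5/3) ^ S" "q + q' \<le> C * (5/3) ^ Suc S"
    using step.IH by (simp_all add: defs)
  have "C \<ge> 0" using start(1) by linarith
  have b: "b \<ge> 1" using pos by (simp add: defs Suc_le_eq)
  have pow: "real k + 2/3 \<le> (5/3) ^ k \<and> real k + 5/3 \<le> (5/3) ^ Suc k" if "k \<ge> 1" for k
    using that by (induction k rule: dec_induct) auto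
  \<comment> \<open>the case \<open>b = 1\<close> needs the bound on the sum of two consecutive denominators\<close>
  have next_den: "real (cf_den a (Suc (Suc n))) = (real b - 1) * q + (q + q')"
    by (simp add: defs algebra_simps)
  have "(real b - 1) * q + (q + q') \<le> (real b - 1) * (C * (5/3) ^ S) + C * (5/3) ^ Suc S"
    using b IH by (intro add_mono mult_left_mono) auto
  also have "\<dots> = C * (5/3) ^ S * (real b + 2/3)" by (simp add: algebra_simps)
  also have "\<dots> \<le> C * (5/3) ^ S * (5/3) ^ b"
    using pow[OF b] \<open>C \<ge> 0\<close> by (intro mult_left_mono) auto
  finally have first: "real (cf_den a (Suc (Suc n))) \<le> C * (5/3) ^ (S + b)"
    by (simp only: next_den power_add mult.assoc)
  have "real (cf_den a (Suc (Suc n))) + q = real b * q + (q + q')"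
    by (simp only: next_den) (simp add: algebra_simps)
  also have "\<dots> \<le> real b * (C * (5/3) ^ S) + C * (5/3) ^ Suc S"
    using b IH by (intro add_mono mult_left_mono) auto
  also have "\<dots> = C * (5/3) ^ S * (real b + 5/3)" by (simp add: algebra_simps)
  also have "\<dots> \<le> C * (5/3) ^ S * (5/3) ^ Suc b"
    using pow[OF b] \<open>C \<ge> 0\<close> by (intro mult_left_mono) auto
  also have "\<dots> = C * (5/3) ^ Suc (S + b)" by (simp add: power_add)
  finally show ?case using first unfolding sum defs by simp
qed

text \<open>
  The numerical inequality behind the second case, for \<open>s = m + 10\<close> and the denominator bound
  \<open>69 * (5/3) ^ m\<close>: it reads \<open>(s + 2) * (s + 3) * q^2 \<le> 4 ^ s\<close>.
\<close>

lemma power_bound_start: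
  "(real m + 12) * (real m + 13) * (69 * (5/3) ^ m)\<^sup>2 \<le> 4 ^ (m + 10)"
proof -
  have sq: "(69 * (5/3) ^ m)\<^sup>2 = (4761 * (25/9) ^ m :: real)" for m :: nat
    by (simp add: power2_eq_square flip: power_mult_distrib)
  have "(real m + 12) * (real m + 13) * (4761 * (25/9) ^ m) \<le> 4 ^ (m + 10)"
  proof (induction m)
    case (Suc m)
    have factor: "(real m + 13) * ((real m + 14) * (25/9)) \<le> (real m + 13) * (4 * (real m + 12))"
      by (intro mult_left_mono) auto
    have "(real (Suc m) + 12) * (real (Suc m) + 13) * (25/9) \<le> 4 * ((real m + 12) * (real m + 13))"
    proof -
      have "real (Suc m) + 12 = real m + 13" "real (Suc m) + 13 = real m + 14" by simp_all
      then show ?thesis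
        using factor by (simp only: ac_simps)
    qed
    then have "(real (Suc m) + 12) * (real (Suc m) + 13) * (25/9) * (4761 * (25/9) ^ m) \<le>
        4 * ((real m + 12) * (real m + 13)) * (4761 * (25/9) ^ m)"
      by (rule mult_right_mono) simp
    also have "\<dots> \<le> 4 * 4 ^ (m + 10)" using Suc.IH by simp
    finally show ?case
      by (simp only: add_Suc power_Suc[of "25/9" m] power_Suc[of 4 "m + 10"] mult.assoc mult.left_commute)
  qed simp
  then show ?thesis unfolding sq .
qed

lemma power_bound_step:
  fixes q :: real
  assumes "(real s + 2) * (real s + 3) * q\<^sup>2 \<le> 4 ^ s" "s < b"
  shows "2 * ((real b + 1) * (real b + 2) * q\<^sup>2) \<le> 2 ^ (s + b)"
proof -
  have "Suc s \<le> b" using assms(2) by simp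
  then show ?thesis
  proof (induction b rule: dec_induct)
    case base
    have "(2::real) ^ (s + Suc s) = 2 * 4 ^ s"
      by (simp add: power_add flip: power_mult_distrib)
    then show ?case using assms(1) by (simp add: add.commute add.left_commute)
  next
    case (step b)
    have "1 * 1 \<le> real b * real b" using step.hyps by (intro mult_mono) auto
    with step.hyps have "(real (Suc b) + 1) * (real (Suc b) + 2) \<le> 2 * ((real b + 1) * (real b + 2))"
      by (simp add: algebra_simps)
    then have "(real (Suc b) + 1) * (real (Suc b) + 2) * q\<^sup>2 \<le> 2 * ((real b + 1) * (real b + 2)) * q\<^sup>2"
      by (rule mult_right_mono) simp
    with step.IH show ?case by simp
  qed
qed

section \<open>Outer convergents\<close>

text \<open>
  The inequality \<open>outer\<close> says that \<open>minkowski r - r\<close> is negative for a convergent \<open>r\<close> below \<open>x\<close> (even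
  \<open>n\<close>) and positive for one above \<open>x\<close> (odd \<open>n\<close>). The first conclusion uses that \<open>r - minkowski r\<close> is
  an integral multiple of \<open>1 / (q * 2 ^ S)\<close>, the second one only its sign.
\<close>

lemma fixed_point_outer_convergent:
  fixes a :: "nat \<Rightarrow> nat" and x :: real and n :: nat
  defines "S \<equiv> \<Sum>i=1..n. a i" and "r \<equiv> cf_value (cf_prefix a n)"
    and "b \<equiv> a (Suc n)" and "q \<equiv> cf_den a (Suc n)" and "q' \<equiv> cf_den a n"
  assumes cf: "is_infinite_cf a x" and fixed: "minkowski x = x"
    and outer: "(-1) ^ n * (r - minkowski r) > 0"
  shows "2 ^ b \<le> 2 * q" "2 ^ (S + b) < 2 * (q * ((b + 1) * q + q'))"
proof -
  have pos: "\<forall>n\<ge>1. a n > 0" using cf by (simp add: is_infinite_cf_def)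
  obtain t where t: "1 / (real b + 1) \<le> t" "t \<le> 1 / real b" "x = cf_tail (cf_prefix a n) t"
    using infinite_cf_tail[OF cf, of n] unfolding b_def by blast
  have b: "b \<ge> 1" using pos by (simp add: b_def Suc_le_eq)
  have "0 < 1 / (real b + 1)" "1 / real b \<le> 1" using b by auto
  with t have t01: "0 < t" "t \<le> 1" by linarith+
  have q: "real q > 0" using cf_den_pos[OF pos, of n] by (simp add: q_def)
  define A where "A = t / (real q * (real q + real q' * t))"
  define B where "B = minkowski t / 2 ^ S"
  define \<delta> where "\<delta> = (-1) ^ n * (r - minkowski r)"
  have "x - r = (-1) ^ n * A"
    using cf_tail_minus_value[OF pos, of t n] t01 by (simp only: t(3) A_def r_def q_def q'_def)
  moreover have "minkowski x - minkowski r = (-1) ^ n * B"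
    using minkowski_cf_tail[OF cf_prefix_pos[OF pos], of t n] t01
    unfolding t(3) B_def r_def S_def sum_list_cf_prefix by (simp del: upt_Suc)
  ultimately have "r - minkowski r = (-1) ^ n * (B - A)"
    using fixed by (simp add: algebra_simps)
  then have "\<delta> = (-1) ^ n * ((-1) ^ n * (B - A))" by (simp add: \<delta>_def)
  then have balance: "B = A + \<delta>"
    by (simp flip: mult.assoc power_mult_distrib)
  have "minkowski t \<le> minkowski (1 / (real b + 0))"
    using t t01 b by (intro minkowski_mono) auto
  also have "\<dots> = 2 / 2 ^ b" using minkowski_inverse_add[of b 0] b by simp
  finally have B: "B \<le> 2 / 2 ^ (S + b)"
    by (simp add: B_def power_add field_simps)
  have A: "1 / (real q * ((real b + 1) * real q + real q')) \<le> A"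
  proof -
    have "1 \<le> t * (real b + 1)" using t(1) by (simp add: field_simps)
    then have "real q \<le> t * (real b + 1) * real q" using q by (simp add: mult_le_cancel_right1)
    then have "real q + real q' * t \<le> t * ((real b + 1) * real q + real q')"
      by (simp add: algebra_simps)
    moreover have "real q + real q' * t > 0" "(real b + 1) * real q + real q' > 0"
      using q t01 by (auto intro!: add_pos_nonneg)
    ultimately have "1 / ((real b + 1) * real q + real q') \<le> t / (real q + real q' * t)"
      by (simp add: field_simps)
    then have "1 / real q * (1 / ((real b + 1) * real q + real q')) \<le>
        1 / real q * (t / (real q + real q' * t))"
      by (rule mult_left_mono) simp
    then show ?thesis by (simp add: A_def)
  qed
  have "\<delta> > 0" using outer by (simp add: \<delta>_def)
  have "1 / (real q * ((real b + 1) * real q + real q')) < 2 / 2 ^ (S + b)"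
    using A B balance \<open>\<delta> > 0\<close> by linarith
  then have "2 ^ (S + b) < 2 * (real q * ((real b + 1) * real q + real q'))"
    using q by (simp add: field_simps add_pos_nonneg)
  also have "\<dots> = real (2 * (q * ((b + 1) * q + q')))" by (simp add: algebra_simps)
  finally show "2 ^ (S + b) < 2 * (q * ((b + 1) * q + q'))"
    by (metis of_nat_less_iff of_nat_numeral of_nat_power)
  have "1 / (real q * 2 ^ S) \<le> \<delta>"
  proof -
    obtain m :: int where m: "minkowski r = of_int m / 2 ^ S"
      using minkowski_cf_value_dyadic[OF cf_prefix_pos[OF pos], of n]
      unfolding r_def S_def sum_list_cf_prefix by blast
    have r: "r = real (cf_num a (Suc n)) / real q"
      using cf_tail_prefix[OF pos, of 0 n] by (simp add: r_def q_def cf_tail_0 del: upt_Suc)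
    define k :: int where "k = (-1) ^ n * (int (cf_num a (Suc n)) * 2 ^ S - m * int q)"
    have k: "\<delta> = of_int k / (real q * 2 ^ S)"
    proof -
      have "r - minkowski r = real (cf_num a (Suc n)) / real q - of_int m / 2 ^ S"
        by (simp only: m) (simp only: r)
      also have "\<dots> = of_int (int (cf_num a (Suc n)) * 2 ^ S - m * int q) / (real q * 2 ^ S)"
        using q by (simp add: field_simps)
      finally show ?thesis by (simp add: \<delta>_def k_def)
    qed
    moreover have "real q * 2 ^ S > 0" using q by simp
    ultimately have "k > 0" using \<open>\<delta> > 0\<close> by (simp only: zero_less_divide_iff of_int_0_less_iff) linarith
    then have "real_of_int k \<ge> 1" by linarith
    then show ?thesis using q unfolding k by (intro divide_right_mono) auto
  qed
  moreover have "A \<ge> 0" using t01 q by (simp add: A_def)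
  ultimately have "1 / (real q * 2 ^ S) \<le> 2 / 2 ^ (S + b)" using B balance by linarith
  then have "real (2 ^ b) \<le> real (2 * q)"
    using q by (simp add: power_add field_simps)
  then show "2 ^ b \<le> 2 * q" by (simp only: of_nat_le_iff)
qed

text \<open>
  If the function were not below the identity somewhere to the left of the smallest fixed point,
  the intermediate value theorem between \<open>29/69\<close> and that place would give a smaller fixed point.
\<close>

lemma minkowski_less_below_smallest:
  assumes "\<forall>y\<in>fixed_points. x \<le> y" "0 < y" "y < x" "x < 1/2"
  shows "minkowski y < y"
proof (rule ccontr)
  assume "\<not> minkowski y < y"
  with minkowski_less_left[of y] assms(2) have y: "29/69 < y" "y \<le> minkowski y" by force+
  have "\<exists>z\<ge>29/69. z \<le> y \<and> minkowski z - z = 0"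
    using y assms minkowski_less_left[of "29/69"]
    by (intro IVT' continuous_intros continuous_on_subset[OF continuous_on_minkowski]) auto
  then obtain z where "29/69 \<le> z" "z \<le> y" "minkowski z = z" by auto
  moreover from this assms have "z \<in> fixed_points" by (simp add: fixed_points_eq)
  ultimately show False using assms by force
qed

lemma minkowski_greater_above_greatest:
  assumes "\<forall>y\<in>fixed_points. y \<le> x" "x < y" "y < 1/2" "0 < x"
  shows "y < minkowski y"
proof (rule ccontr)
  assume "\<not> y < minkowski y"
  with minkowski_greater_right[of y] assms(3) have y: "y < 37/88" "minkowski y \<le> y" by force+
  have "\<exists>z\<ge>y. z \<le> 37/88 \<and> minkowski z - z = 0"
    using y assms minkowski_greater_right[of "37/88"]
    by (intro IVT' continuous_intros continuous_on_subset[OF continuous_on_minkowski]) auto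
  then obtain z where "y \<le> z" "z \<le> 37/88" "minkowski z = z" by auto
  moreover from this assms have "z \<in> fixed_points" by (simp add: fixed_points_eq)
  ultimately show False using assms by force
qed

lemma convergent_between_0_half:
  assumes cf: "is_infinite_cf a x" and "a 1 = 2" "n \<ge> 2"
  shows "0 < cf_value (cf_prefix a n)" "cf_value (cf_prefix a n) < 1/2"
proof -
  have pos: "\<forall>n\<ge>1. a n > 0" using cf by (simp add: is_infinite_cf_def)
  have "[1..<Suc n] = 1 # 2 # [3..<Suc n]"
    using assms(3) by (simp add: upt_conv_Cons numeral_eq_Suc)
  then have eq: "cf_value (cf_prefix a n) = 1 / (2 + 1 / (real (a 2) + cf_value (map a [3..<Suc n])))"
    using assms(2) by simp
  have "0 \<le> cf_value (map a [3..<Suc n])"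
    using cf_tail_in_unit[of "map a [3..<Suc n]" 0] pos by (simp add: cf_tail_0 del: upt_Suc)
  moreover have "a 2 > 0" using pos by simp
  ultimately have "0 < 1 / (real (a 2) + cf_value (map a [3..<Suc n]))"
    by (simp add: add_pos_nonneg)
  then show "0 < cf_value (cf_prefix a n)" "cf_value (cf_prefix a n) < 1/2"
    unfolding eq by (simp_all add: field_simps)
qed

lemma convergent_side:
  assumes cf: "is_infinite_cf a x"
  shows "(-1) ^ n * (x - cf_value (cf_prefix a n)) > 0"
proof -
  have pos: "\<forall>n\<ge>1. a n > 0" using cf by (simp add: is_infinite_cf_def)
  obtain t where t: "1 / (real (a (Suc n)) + 1) \<le> t" "x = cf_tail (cf_prefix a n) t"
    using cf by (rule infinite_cf_tail)
  have "t > 0" using t(1) by (rule less_le_trans[rotated]) simp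
  moreover have "real (cf_den a (Suc n)) > 0" using cf_den_pos[OF pos, of n] by simp
  ultimately have "0 < t / (real (cf_den a (Suc n)) * (real (cf_den a (Suc n)) + real (cf_den a n) * t))"
    by (intro divide_pos_pos mult_pos_pos add_pos_nonneg) auto
  then show ?thesis
    using \<open>t > 0\<close> cf_tail_minus_value[OF pos, of t n] unfolding t(2)
    by (simp flip: mult.assoc power_mult_distrib del: upt_Suc)
qed

section \<open>The bound on the partial quotients\<close>

lemma fixed_point_digit_le_sum:
  assumes x: "x \<in> fixed_points" and cf: "is_infinite_cf a x" and n: "n \<ge> 6"
    and outer: "(-1) ^ m * (cf_value (cf_prefix a m) - minkowski (cf_value (cf_prefix a m))) > 0"
      "m = n \<or> m = Suc n"
  shows "a (Suc n) \<le> (\<Sum>i=1..n. a i)"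
proof (rule ccontr)
  define b q q' S where "b = a (Suc n)" "q = cf_den a (Suc n)" "q' = cf_den a n" "S = (\<Sum>i=1..n. a i)"
  note defs = b_q_q'_S_def
  assume "\<not> a (Suc n) \<le> (\<Sum>i=1..n. a i)"
  then have big: "S < b" by (simp add: defs)
  have pos: "\<forall>n\<ge>1. a n > 0" using cf by (simp add: is_infinite_cf_def)
  have fixed: "minkowski x = x" using x by (simp add: fixed_points_eq)
  from outer(2) show False
  proof
    assume "m = n"
    with fixed_point_outer_convergent(1)[OF cf fixed, of n] outer(1)
    have "2 ^ b \<le> 2 * q" by (simp add: defs del: upt_Suc)
    also have "\<dots> < 2 * 2 ^ S" using cf_den_less[OF pos, of n] n by (simp add: defs)
    also have "\<dots> = 2 ^ Suc S" by simp
    finally have "b < Suc S" by (rule power_less_imp_less_exp[rotated]) simp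
    with big show False by simp
  next
    assume "m = Suc n"
    define c q1 where "c = a (Suc (Suc n))" "q1 = cf_den a (Suc (Suc n))"
    have q1: "q1 = b * q + q'" by (simp add: defs c_q1_def)
    have sum: "(\<Sum>i=1..Suc n. a i) = S + b" by (simp add: defs)
    have "2 ^ (S + b + c) < 2 * (q1 * ((c + 1) * q1 + q))"
      using fixed_point_outer_convergent(2)[OF cf fixed, of "Suc n"] outer(1) \<open>m = Suc n\<close>
      unfolding c_q1_def sum defs by simp
    also have "\<dots> \<le> 2 * (((b + 1) * q) * (2 ^ c * ((b + 2) * q)))"
    proof -
      have q1_le: "q1 \<le> (b + 1) * q" using cf_den_mono[OF pos, of n] by (simp add: q1 defs)
      have c: "c + 1 \<le> 2 ^ c" using less_exp[of c] by (simp add: Suc_le_eq)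
      have "(c + 1) * q1 + q \<le> 2 ^ c * ((b + 1) * q) + 2 ^ c * q"
        by (intro add_mono mult_mono c q1_le) auto
      also have "\<dots> = 2 ^ c * ((b + 2) * q)" by (simp add: algebra_simps)
      finally show ?thesis using q1_le by (intro mult_left_mono mult_mono) auto
    qed
    also have "\<dots> = 2 ^ c * (2 * ((b + 1) * (b + 2) * q\<^sup>2))"
      by (simp add: power2_eq_square algebra_simps)
    finally have "2 ^ c * 2 ^ (S + b) < 2 ^ c * (2 * ((b + 1) * (b + 2) * q\<^sup>2))"
      by (simp only: power_add[of 2 "S + b" c] mult.commute[of "2 ^ (S + b)" "2 ^ c"])
    then have "2 ^ (S + b) < 2 * ((b + 1) * (b + 2) * q\<^sup>2)" by simp
    then have "real (2 ^ (S + b)) < real (2 * ((b + 1) * (b + 2) * q\<^sup>2))" by (simp only: of_nat_less_iff)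
    also have "\<dots> = 2 * ((real b + 1) * (real b + 2) * (real q)\<^sup>2)"
      by (simp add: algebra_simps)
    finally have "2 ^ (S + b) < 2 * ((real b + 1) * (real b + 2) * (real q)\<^sup>2)"
      by simp
    moreover have "2 * ((real b + 1) * (real b + 2) * (real q)\<^sup>2) \<le> 2 ^ (S + b)"
    proof (rule power_bound_step[OF _ big])
      note digits = fixed_point_first_digits[OF x cf]
      define l where "l = (\<Sum>i\<in>{6<..n}. a i)"
      have "S = (\<Sum>i=1..6. a i) + l"
      proof -
        have "{1..n} = {1..6} \<union> {6<..n}" using n by auto
        moreover have "(\<Sum>i\<in>{1..6} \<union> {6<..n}. a i) = (\<Sum>i=1..6. a i) + (\<Sum>i\<in>{6<..n}. a i)"
          by (rule sum.union_disjoint) auto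
        ultimately show ?thesis by (simp only: defs l_def)
      qed
      then have S: "S = l + 10" using digits by (simp add: eval_nat_numeral)
      \<comment> \<open>the denominators of the convergents of \<open>[2,2,1,1,1,3]\<close> and \<open>[2,2,1,1,1]\<close>\<close>
      have den: "cf_den a 7 = 69" "cf_den a 6 = 19"
        using digits by (simp_all add: eval_nat_numeral)
      have "real q \<le> 69 * (5/3) ^ l"
        using cf_den_growth[OF pos _ _ n, of 69] den by (simp add: defs l_def)
      then have "(real q)\<^sup>2 \<le> (69 * (5/3) ^ l)\<^sup>2" by (intro power_mono) auto
      then have "(real l + 12) * (real l + 13) * (real q)\<^sup>2 \<le> (real l + 12) * (real l + 13) * (69 * (5/3) ^ l)\<^sup>2"
        by (intro mult_left_mono) auto
      also have "\<dots> \<le> 4 ^ S" unfolding S by (rule power_bound_start)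
      finally show "(real S + 2) * (real S + 3) * (real q)\<^sup>2 \<le> 4 ^ S" by (simp add: S add.commute)
    qed
    ultimately show False by linarith
  qed
qed

theorem theorem1:
  fixes x :: real and a :: "nat \<Rightarrow> nat"
  assumes extremal: "(x \<in> fixed_points \<and> (\<forall>y\<in>fixed_points. x \<le> y)) \<or>
                     (x \<in> fixed_points \<and> (\<forall>y\<in>fixed_points. y \<le> x))"
    and expansion: "is_infinite_cf a x"
  shows "a 1 = 2 \<and> (\<forall>n\<ge>1. a (n + 1) \<le> (\<Sum>i=1..n. a i))"
proof -
  have x: "x \<in> fixed_points" using extremal by blast
  then have x_bounds: "0 < x" "x < 1/2" by (auto simp: fixed_points_eq)
  note digits = fixed_point_first_digits[OF x expansion]
  define r where "r m = cf_value (cf_prefix a m)" for m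
  have outer_convergent: "\<exists>m. (m = n \<or> m = Suc n) \<and> (-1) ^ m * (r m - minkowski (r m)) > 0"
    if "n \<ge> 2" for n
  proof -
    have r: "0 < r m" "r m < 1/2" "(-1) ^ m * (x - r m) > 0" if "m \<ge> 2" for m
      using convergent_between_0_half[OF expansion digits(1) that] convergent_side[OF expansion, of m]
      by (simp_all add: r_def)
    from extremal show ?thesis
    proof
      assume smallest: "x \<in> fixed_points \<and> (\<forall>y\<in>fixed_points. x \<le> y)"
      define m where "m = (if even n then n else Suc n)"
      have m: "even m" "m \<ge> 2" "m = n \<or> m = Suc n" using that by (auto simp: m_def)
      then have "minkowski (r m) < r m"
        using r[of m] x_bounds smallest by (intro minkowski_less_below_smallest[of x]) auto
      with m show ?thesis by (intro exI[of _ m]) simp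
    next
      assume greatest: "x \<in> fixed_points \<and> (\<forall>y\<in>fixed_points. y \<le> x)"
      define m where "m = (if odd n then n else Suc n)"
      have m: "odd m" "m \<ge> 2" "m = n \<or> m = Suc n" using that by (auto simp: m_def)
      then have "r m < minkowski (r m)"
        using r[of m] x_bounds greatest by (intro minkowski_greater_above_greatest[of x]) auto
      with m show ?thesis by (intro exI[of _ m]) simp
    qed
  qed
  have "a (n + 1) \<le> (\<Sum>i=1..n. a i)" if "n \<ge> 1" for n
  proof (cases "n \<ge> 6")
    case True
    then obtain m where "m = n \<or> m = Suc n" "(-1) ^ m * (r m - minkowski (r m)) > 0"
      using outer_convergent[of n] by auto
    then show ?thesis
      using fixed_point_digit_le_sum[OF x expansion True, of m] by (simp add: r_def del: upt_Suc)
  next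
    case False
    then have "n \<in> {1, 2, 3, 4, 5}" using that by auto
    then show ?thesis using digits by (auto simp: eval_nat_numeral)
  qed
  with digits(1) show ?thesis by blast
qed

end
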